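(* There is an absolute constant $c>0$ such that $I_n \ge c\, n^{2/3}$ for every positive integer $n$; that is, $I_n=\Omega(n^{2/3})$, where $I_n$ is the independent geometric domination number of the $n\times n$ grid.
   Context: The $n\times n$ grid is $\{1,\dots,n\}\times\{1,\dots,n\}$. Three points are collinear if they lie on a common straight line in the plane. A set is in general position if no three distinct points of it are collinear. A point $p$ of the grid is dominated by a subset $S$ of the grid if $p\in S$ or there exist two distinct points $x,y\in S$ such that $x,y,p$ are collinear. A subset $S$ of the grid is a (geometric) dominating set if every point of the grid is dominated by $S$. The independent (geometric) domination number $I_n$ is the smallest size of a dominating set of the $n\times n$ grid that is in general position. *)

theory Defs
  imports "HOL-Analysis.Analysis"
begin

text \<open>The grid is embedded in the real plane so that the library predicate \<^const>\<open>collinear\<close>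
  (all points of the set lie on a common line) applies to its points.\<close>

definition grid :: "nat \<Rightarrow> (real \<times> real) set" where
  "grid n = (\<lambda>(i, j). (real i, real j)) ` ({1..n} \<times> {1..n})"

definition general_position :: "(real \<times> real) set \<Rightarrow> bool" where
  "general_position S \<longleftrightarrow>
     (\<forall>x\<in>S. \<forall>y\<in>S. \<forall>z\<in>S. x \<noteq> y \<and> y \<noteq> z \<and> x \<noteq> z \<longrightarrow> \<not> collinear {x, y, z})"

definition dominated_by :: "(real \<times> real) set \<Rightarrow> real \<times> real \<Rightarrow> bool" where
  "dominated_by S p \<longleftrightarrow> p \<in> S \<or> (\<exists>x\<in>S. \<exists>y\<in>S. x \<noteq> y \<and> collinear {x, y, p})"

definition geom_dominating :: "nat \<Rightarrow> (real \<times> real) set \<Rightarrow> bool" where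
  "geom_dominating n S \<longleftrightarrow> S \<subseteq> grid n \<and> (\<forall>p\<in>grid n. dominated_by S p)"

definition indep_geom_dom_number :: "nat \<Rightarrow> nat" where
  "indep_geom_dom_number n =
     (LEAST k. \<exists>S. geom_dominating n S \<and> general_position S \<and> card S = k)"

lemma finite_grid [simp]: "finite (grid n)"
  by (simp add: grid_def)

text \<open>An inclusion-maximal subset of the grid in general position is dominating, so the minimum in
  \<^const>\<open>indep_geom_dom_number\<close> is taken over a nonempty set.\<close>

lemma indep_geom_dominating_exists: "\<exists>S. geom_dominating n S \<and> general_position S"
proof -
  let ?F = "{S. S \<subseteq> grid n \<and> general_position S}"
  have fin: "finite ?F" by simp
  have "{} \<in> ?F" by (simp add: general_position_def)
  then have ne: "?F \<noteq> {}" by blast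
  obtain S where S: "S \<in> ?F" and mx: "\<forall>T\<in>?F. S \<subseteq> T \<longrightarrow> S = T"
    using finite_has_maximal[OF fin ne] by blast
  have "dominated_by S p" if p: "p \<in> grid n" for p
  proof (rule ccontr)
    assume nd: "\<not> dominated_by S p"
    have nc: "\<not> collinear {x, y, p}" if "x \<in> S" "y \<in> S" "x \<noteq> y" for x y
      using nd that unfolding dominated_by_def by blast
    have perm: "{x, p, y} = {x, y, p}" "{p, x, y} = {x, y, p}" for x y
      by auto
    have gp: "\<not> collinear {x, y, z}"
      if "x \<in> S" "y \<in> S" "z \<in> S" "x \<noteq> y" "y \<noteq> z" "x \<noteq> z" for x y z
      using S that unfolding general_position_def by blast
    have "general_position (insert p S)"
      unfolding general_position_def
    proof (intro ballI impI)
      fix x y z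
      assume mem: "x \<in> insert p S" "y \<in> insert p S" "z \<in> insert p S"
        and d: "x \<noteq> y \<and> y \<noteq> z \<and> x \<noteq> z"
      consider "x = p" "y \<in> S" "z \<in> S" | "y = p" "x \<in> S" "z \<in> S"
        | "z = p" "x \<in> S" "y \<in> S" | "x \<in> S" "y \<in> S" "z \<in> S"
        using mem d by blast
      then show "\<not> collinear {x, y, z}"
      proof cases
        case 1
        then show ?thesis using nc[of y z] d by (simp only: perm simp_thms)
      next
        case 2
        then show ?thesis using nc[of x z] d by (simp only: perm simp_thms)
      next
        case 3
        then show ?thesis using nc[of x y] d by simp
      next
        case 4
        then show ?thesis using gp d by blast
      qed
    qed
    then have "insert p S \<in> ?F" using S p by simp
    with mx have "S = insert p S" by blast
    then show False using nd unfolding dominated_by_def by blast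
  qed
  then show ?thesis using S unfolding geom_dominating_def by blast
qed

lemma indep_geom_dom_number_attained:
  "\<exists>S. geom_dominating n S \<and> general_position S \<and> card S = indep_geom_dom_number n"
  unfolding indep_geom_dom_number_def
  by (rule LeastI_ex) (use indep_geom_dominating_exists in blast)

lemma indep_geom_dom_number_le:
  "geom_dominating n S \<Longrightarrow> general_position S \<Longrightarrow> indep_geom_dom_number n \<le> card S"
  unfolding indep_geom_dom_number_def by (rule Least_le) blast

end

theory Submission
  imports Defs
begin

text \<open>Fix a point \<open>x\<close> of a dominating set \<open>S\<close> in general position, \<open>s = |S|\<close>. The lines joining \<open>x\<close> to
  the other points of \<open>S\<close> have pairwise distinct primitive directions, and a line whose primitive
  direction has sup norm \<open>m\<close> meets the grid in \<open>O(n/m)\<close> points. There are only \<open>O(k)\<close> lattice vectors of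
  sup norm \<open>k\<close>, so \<open>s\<close> distinct directions contribute at most \<open>O(n \<surd>s)\<close> grid points, as one sees by
  splitting the directions at norm \<open>\<surd>s\<close>. Summing over \<open>x\<close> gives \<open>n\<^sup>2 = O(n s \<surd>s)\<close>.\<close>

section \<open>Integer coordinates and primitive directions\<close>

definition supn :: "int \<times> int \<Rightarrow> int" where
  "supn v = max \<bar>fst v\<bar> \<bar>snd v\<bar>"

text \<open>Signs are kept, so \<open>v\<close> and \<open>-v\<close> get different directions. Only
  one implication matters below: equal directions force the same line.\<close>

definition prim_dir :: "int \<times> int \<Rightarrow> int \<times> int" where
  "prim_dir v = (let g = gcd (fst v) (snd v) in (fst v div g, snd v div g))"

text \<open>Lets gcd and Bezout arguments run over the integers while \<open>collinear\<close> is a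
  predicate on the real plane.\<close>

definition real_pt :: "int \<times> int \<Rightarrow> real \<times> real" where
  "real_pt v = (real_of_int (fst v), real_of_int (snd v))"

lemma inj_real_pt: "inj real_pt"
  by (auto simp: inj_def real_pt_def prod_eq_iff)

lemma grid_eq_real_pt: "grid n = real_pt ` ({1..int n} \<times> {1..int n})"
proof -
  have "real_pt ` ({1..int n} \<times> {1..int n})
      = real_pt ` (\<lambda>(i, j). (int i, int j)) ` ({1..n} \<times> {1..n})"
  proof (rule arg_cong[where f = "image real_pt"], rule set_eqI)
    fix v :: "int \<times> int"
    show "v \<in> {1..int n} \<times> {1..int n} \<longleftrightarrow> v \<in> (\<lambda>(i, j). (int i, int j)) ` ({1..n} \<times> {1..n})"
    proof
      assume "v \<in> {1..int n} \<times> {1..int n}"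
      then show "v \<in> (\<lambda>(i, j). (int i, int j)) ` ({1..n} \<times> {1..n})"
        by (intro image_eqI[of _ _ "(nat (fst v), nat (snd v))"]) auto
    qed auto
  qed
  also have "\<dots> = grid n"
    by (auto simp: grid_def real_pt_def image_image case_prod_beta)
  finally show ?thesis by simp
qed

lemma prim_dir_decomp:
  assumes "v \<noteq> 0"
  obtains g where "g > 0" "fst v = g * fst (prim_dir v)" "snd v = g * snd (prim_dir v)"
    "coprime (fst (prim_dir v)) (snd (prim_dir v))"
proof
  let ?g = "gcd (fst v) (snd v)"
  have nz: "fst v \<noteq> 0 \<or> snd v \<noteq> 0"
    using assms by (auto simp: prod_eq_iff)
  then show "?g > 0" by auto
  show "fst v = ?g * fst (prim_dir v)" "snd v = ?g * snd (prim_dir v)"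
    by (simp_all add: prim_dir_def Let_def)
  show "coprime (fst (prim_dir v)) (snd (prim_dir v))"
    using nz div_gcd_coprime[of "fst v" "snd v"] by (simp add: prim_dir_def Let_def)
qed

text \<open>The norm serves as a denominator, hence the lower bound. The upper bound keeps it at
  most \<open>n\<close> for the difference of two grid points.\<close>

lemma supn_prim_dir:
  assumes "v \<noteq> 0"
  shows "1 \<le> supn (prim_dir v)" "supn (prim_dir v) \<le> supn v"
proof -
  obtain g where g: "g > 0" "fst v = g * fst (prim_dir v)" "snd v = g * snd (prim_dir v)"
    "coprime (fst (prim_dir v)) (snd (prim_dir v))"
    using prim_dir_decomp[OF assms] .
  have "fst (prim_dir v) \<noteq> 0 \<or> snd (prim_dir v) \<noteq> 0"
    using g(4) by auto
  then show "1 \<le> supn (prim_dir v)" unfolding supn_def by linarith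
  have "\<bar>a\<bar> \<le> \<bar>g * a\<bar>" for a
    using g(1) mult_right_mono[of 1 g "\<bar>a\<bar>"] by (simp add: abs_mult)
  from this[of "fst (prim_dir v)"] this[of "snd (prim_dir v)"]
  show "supn (prim_dir v) \<le> supn v"
    unfolding supn_def g(2,3)[symmetric] by linarith
qed

section \<open>Lattice points on a line\<close>

lemma collinear_real_pt_cross:
  assumes "collinear {real_pt x, real_pt y, real_pt p}"
  shows "fst (y - x) * snd (p - x) = snd (y - x) * fst (p - x)"
proof -
  obtain u where u: "\<forall>a\<in>{real_pt x, real_pt y, real_pt p}. \<forall>b\<in>{real_pt x, real_pt y, real_pt p}.
      \<exists>c. a - b = c *\<^sub>R u"
    using assms unfolding collinear_def by blast
  obtain c d where "real_pt y - real_pt x = c *\<^sub>R u" "real_pt p - real_pt x = d *\<^sub>R u"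
    using u by blast
  then have "real_of_int (fst y - fst x) = c * fst u" "real_of_int (snd y - snd x) = c * snd u"
    "real_of_int (fst p - fst x) = d * fst u" "real_of_int (snd p - snd x) = d * snd u"
    by (auto simp: real_pt_def prod_eq_iff)
  then have "real_of_int (fst y - fst x) * real_of_int (snd p - snd x)
      = real_of_int (snd y - snd x) * real_of_int (fst p - fst x)"
    by (simp only: mult_ac)
  then show ?thesis
    by (simp only: of_int_mult[symmetric] of_int_eq_iff fst_diff snd_diff)
qed

text \<open>This is how general position enters: contraposed, it makes the directions from
  \<open>x\<close> to the other points of the set pairwise distinct.\<close>

lemma collinear_same_prim_dir:
  assumes "y \<noteq> x" "z \<noteq> x" "prim_dir (y - x) = prim_dir (z - x)"
  shows "collinear {real_pt x, real_pt y, real_pt z}"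
proof -
  define d where "d = prim_dir (y - x)"
  obtain g where g: "fst (y - x) = g * fst d" "snd (y - x) = g * snd d"
    using prim_dir_decomp[of "y - x"] assms(1) unfolding d_def by auto
  obtain h where h: "fst (z - x) = h * fst d" "snd (z - x) = h * snd d"
    using prim_dir_decomp[of "z - x"] assms(2,3) unfolding d_def by auto
  have y: "real_pt y = real_pt x + real_of_int g *\<^sub>R real_pt d"
    using g by (simp add: real_pt_def prod_eq_iff algebra_simps flip: of_int_mult of_int_add)
  have z: "real_pt z = real_pt x + real_of_int h *\<^sub>R real_pt d"
    using h by (simp add: real_pt_def prod_eq_iff algebra_simps flip: of_int_mult of_int_add)
  have "\<exists>t. a = real_pt x + t *\<^sub>R real_pt d" if "a \<in> {real_pt x, real_pt y, real_pt z}" for a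
    using that y z by (auto intro: exI[of _ 0])
  moreover have "\<exists>c. (real_pt x + t *\<^sub>R real_pt d) - (real_pt x + t' *\<^sub>R real_pt d) = c *\<^sub>R real_pt d"
    for t t' by (rule exI[of _ "t - t'"]) (simp add: algebra_simps)
  ultimately show ?thesis
    unfolding collinear_def by metis
qed

text \<open>Because the direction \<open>(a, b)\<close> is primitive, the lattice points on the line
  are exactly \<open>x + t (a, b)\<close> with \<open>t\<close> an integer, and staying in the grid
  forces \<open>\<bar>t\<bar> * m \<le> n\<close>.\<close>

lemma card_grid_line_le:
  assumes x: "x \<in> {1..int n} \<times> {1..int n}" and y: "y \<in> {1..int n} \<times> {1..int n}" and "x \<noteq> y"
  defines "L \<equiv> {p \<in> {1..int n} \<times> {1..int n}. fst (y - x) * snd (p - x) = snd (y - x) * fst (p - x)}"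
  shows "real (card L) \<le> 3 * real n / real_of_int (supn (prim_dir (y - x)))"
proof -
  define a b m where "a = fst (prim_dir (y - x))" and "b = snd (prim_dir (y - x))"
    and "m = supn (prim_dir (y - x))"
  have nz: "y - x \<noteq> 0" using \<open>x \<noteq> y\<close> by simp
  obtain g where g: "g > 0" "fst (y - x) = g * a" "snd (y - x) = g * b" "coprime a b"
    using prim_dir_decomp[OF nz] unfolding a_def b_def .
  have m1: "m \<ge> 1" and "m \<le> supn (y - x)"
    unfolding m_def using supn_prim_dir[OF nz] by auto
  then have mn: "m \<le> int n"
    using x y by (auto simp: supn_def)
  obtain u w where uw: "u * a + w * b = 1"
    using bezout_int[of a b] g(4) by (auto simp: coprime_iff_gcd_eq_1)
  define q where "q = int n div m"
  have "L \<subseteq> (\<lambda>t. x + (t * a, t * b)) ` {-q..q}"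
  proof
    fix p assume "p \<in> L"
    then have p: "p \<in> {1..int n} \<times> {1..int n}"
      and "fst (y - x) * snd (p - x) = snd (y - x) * fst (p - x)"
      by (auto simp: L_def)
    then have cross: "a * snd (p - x) = b * fst (p - x)"
      using g(1) unfolding g(2,3) by (simp add: mult.assoc)
    \<comment> \<open>The Bezout coefficients recover the multiplier from the vector
      \<open>p - x\<close> without any division, so it is an integer.\<close>
    define t where "t = u * fst (p - x) + w * snd (p - x)"
    have "t * a = (u * a + w * b) * fst (p - x)"
      using cross unfolding t_def by algebra
    then have ta: "t * a = fst (p - x)" using uw by simp
    have "t * b = (u * a + w * b) * snd (p - x)"
      using cross unfolding t_def by algebra
    then have tb: "t * b = snd (p - x)" using uw by simp
    have "\<bar>t * a\<bar> \<le> int n" "\<bar>t * b\<bar> \<le> int n"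
      unfolding ta tb using x p by auto
    then have "\<bar>t\<bar> * m \<le> int n"
      by (auto simp: m_def supn_def a_def b_def abs_mult max_def)
    then have "\<bar>t\<bar> \<le> q"
      unfolding q_def using zdiv_mono1[of "\<bar>t\<bar> * m" "int n" m] m1 by simp
    moreover have "p = x + (t * a, t * b)"
      using ta tb by (simp add: prod_eq_iff)
    ultimately show "p \<in> (\<lambda>t. x + (t * a, t * b)) ` {-q..q}"
      by (intro image_eqI[of _ _ t]) auto
  qed
  then have "card L \<le> card {-q..q}"
    by (rule surj_card_le[rotated]) simp
  also have "\<dots> = nat (2 * q + 1)" by simp
  finally have card_le: "card L \<le> nat (2 * q + 1)" .
  have "q \<ge> 0" unfolding q_def using m1 by (simp add: pos_imp_zdiv_nonneg_iff)
  with card_le have "real (card L) \<le> real_of_int (2 * q + 1)" by linarith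
  moreover have "real_of_int q \<le> real n / real_of_int m"
    unfolding q_def using real_of_int_div4[of "int n" m] by simp
  \<comment> \<open>Since \<open>y\<close> is itself a grid point, \<open>m\<close> is at most
    \<open>n\<close>; this absorbs the 1 in \<open>2 * q + 1\<close> and yields the factor
    3.\<close>
  moreover have "1 \<le> real n / real_of_int m"
    using m1 mn by (simp add: divide_simps)
  ultimately have "real (card L) \<le> 3 * (real n / real_of_int m)" by simp
  then show ?thesis by (simp add: m_def)
qed

section \<open>Reciprocal norms summed over distinct directions\<close>

lemma card_supn_eq_le:
  assumes "k \<ge> 1"
  shows "finite {v. supn v = int k}" "card {v. supn v = int k} \<le> 12 * k"
proof -
  let ?I = "{- int k..int k}"
  \<comment> \<open>The boundary of a square as two pairs of opposite sides. The corners are counted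
    twice, which only affects the constant.\<close>
  let ?B = "({int k, - int k} \<times> ?I) \<union> (?I \<times> {int k, - int k})"
  have sub: "{v. supn v = int k} \<subseteq> ?B"
    by (auto simp: supn_def max_def split: if_splits)
  then show "finite {v. supn v = int k}"
    by (rule finite_subset) simp
  have "card {v. supn v = int k} \<le> card ?B"
    by (rule card_mono[OF _ sub]) simp
  also have "\<dots> \<le> card ({int k, - int k} \<times> ?I) + card (?I \<times> {int k, - int k})"
    by (rule card_Un_le)
  also have "\<dots> = 4 * (2 * k + 1)"
    using assms by (simp add: card_cartesian_product nat_add_distrib nat_mult_distrib)
  also have "\<dots> \<le> 12 * k" using assms by simp
  finally show "card {v. supn v = int k} \<le> 12 * k" .
qed

text \<open>The shell of norm \<open>k\<close> has at most \<open>12 * k\<close> vectors of weight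
  \<open>1 / k\<close>, so every shell contributes at most 12.\<close>

lemma sum_inverse_supn_shell_le:
  "(\<Sum>v | 1 \<le> supn v \<and> supn v \<le> int M. 1 / real_of_int (supn v)) \<le> 12 * real M"
proof -
  have eq: "{v. 1 \<le> supn v \<and> supn v \<le> int M} = (\<Union>k\<in>{1..M}. {v. supn v = int k})"
  proof (intro equalityI subsetI)
    fix v assume "v \<in> {v. 1 \<le> supn v \<and> supn v \<le> int M}"
    then show "v \<in> (\<Union>k\<in>{1..M}. {v. supn v = int k})"
      by (intro UN_I[of "nat (supn v)"]) auto
  qed auto
  have "(\<Sum>v | 1 \<le> supn v \<and> supn v \<le> int M. 1 / real_of_int (supn v))
      = (\<Sum>k\<in>{1..M}. \<Sum>v | supn v = int k. 1 / real_of_int (supn v))"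
    unfolding eq by (rule sum.UNION_disjoint) (auto simp: card_supn_eq_le)
  also have "\<dots> \<le> (\<Sum>k\<in>{1..M}. 12)"
  proof (rule sum_mono)
    fix k assume "k \<in> {1..M}"
    then have k: "k \<ge> 1" by simp
    have "real (card {v. supn v = int k}) \<le> 12 * real k"
      using card_supn_eq_le(2)[OF k] by linarith
    then show "(\<Sum>v | supn v = int k. 1 / real_of_int (supn v)) \<le> 12"
      using k by (simp add: divide_simps)
  qed
  finally show ?thesis by simp
qed

lemma sum_inverse_supn_le:
  assumes "finite D" and pos: "\<And>v. v \<in> D \<Longrightarrow> 1 \<le> supn v" and card: "card D \<le> s" and "s \<ge> 1"
  shows "(\<Sum>v\<in>D. 1 / real_of_int (supn v)) \<le> 25 * sqrt (real s)"
proof -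
  \<comment> \<open>This threshold balances the two halves. Rounding up makes every vector beyond
    \<open>M\<close> longer than \<open>sqrt s\<close>, and \<open>M \<le> 2 * sqrt s\<close>
    because \<open>s \<ge> 1\<close>, so the total constant is 12 * 2 + 1 = 25.\<close>
  define M where "M = nat \<lceil>sqrt (real s)\<rceil>"
  have s1: "sqrt (real s) \<ge> 1" using \<open>s \<ge> 1\<close> by simp
  have M: "sqrt (real s) \<le> real M" "real M \<le> sqrt (real s) + 1"
    unfolding M_def using s1 by linarith+
  have fin: "finite {v. 1 \<le> supn v \<and> supn v \<le> int M}"
    by (rule finite_subset[of _ "{-int M..int M} \<times> {-int M..int M}"]) (auto simp: supn_def)
  let ?E = "{v\<in>D. supn v \<le> int M}" and ?F = "{v\<in>D. \<not> supn v \<le> int M}"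
  have "D = ?E \<union> ?F" by blast
  then have "(\<Sum>v\<in>D. 1 / real_of_int (supn v)) = (\<Sum>v\<in>?E \<union> ?F. 1 / real_of_int (supn v))"
    by simp
  also have "\<dots> = (\<Sum>v\<in>?E. 1 / real_of_int (supn v)) + (\<Sum>v\<in>?F. 1 / real_of_int (supn v))"
    by (rule sum.union_disjoint) (use \<open>finite D\<close> in auto)
  also have "(\<Sum>v\<in>?E. 1 / real_of_int (supn v)) \<le> 12 * real M"
    by (rule order_trans[OF sum_mono2[OF fin] sum_inverse_supn_shell_le]) (use pos in auto)
  also have "(\<Sum>v\<in>?F. 1 / real_of_int (supn v)) \<le> (\<Sum>v\<in>?F. 1 / sqrt (real s))"
  proof (rule sum_mono)
    fix v assume "v \<in> ?F"
    then have "sqrt (real s) \<le> real_of_int (supn v)" using M by auto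
    then show "1 / real_of_int (supn v) \<le> 1 / sqrt (real s)"
      using s1 by (intro frac_le) auto
  qed
  also have "(\<Sum>v\<in>?F. 1 / sqrt (real s)) \<le> real s / sqrt (real s)"
  proof -
    have "card ?F \<le> s"
      using card_mono[OF \<open>finite D\<close>, of ?F] card by auto
    then show ?thesis by (simp add: divide_right_mono)
  qed
  also have "real s / sqrt (real s) = sqrt (real s)" by (simp add: real_div_sqrt)
  finally show ?thesis using M s1 by linarith
qed

section \<open>Covering the grid by the lines through pairs of points\<close>

lemma dominating_general_position_bound:
  assumes dom: "geom_dominating n S" and gp: "general_position S" and n: "n \<ge> 1"
  defines "s \<equiv> card S"
  shows "s \<ge> 1" "real n \<le> 76 * (real s * sqrt (real s))"
proof -
  let ?G = "{1..int n} \<times> {1..int n}"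
  have Ssub: "S \<subseteq> real_pt ` ?G"
    using dom unfolding geom_dominating_def grid_eq_real_pt by blast
  then obtain T where T: "T \<subseteq> ?G" "S = real_pt ` T"
    by (meson subset_imageE)
  have finT: "finite T" using T(1) by (rule finite_subset) simp
  have cT: "card T = s"
    unfolding s_def T(2) by (rule card_image[symmetric]) (rule inj_on_subset[OF inj_real_pt], simp)
  define L where "L x y = {p \<in> ?G. fst (y - x) * snd (p - x) = snd (y - x) * fst (p - x)}" for x y
  \<comment> \<open>The separate \<open>T\<close> accounts for points dominated by membership alone;
    a one-point set spans no line.\<close>
  have cover: "?G \<subseteq> T \<union> (\<Union>x\<in>T. \<Union>y\<in>T - {x}. L x y)"
  proof
    fix p assume p: "p \<in> ?G"
    then have "dominated_by S (real_pt p)"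
      using dom unfolding geom_dominating_def grid_eq_real_pt by blast
    then consider "real_pt p \<in> real_pt ` T"
      | x y where "x \<in> T" "y \<in> T" "x \<noteq> y" "collinear {real_pt x, real_pt y, real_pt p}"
      unfolding dominated_by_def T(2) by blast
    then show "p \<in> T \<union> (\<Union>x\<in>T. \<Union>y\<in>T - {x}. L x y)"
    proof cases
      case 1
      then show ?thesis using inj_real_pt by (auto simp: inj_image_mem_iff)
    next
      case 2
      then have "p \<in> L x y" unfolding L_def using p collinear_real_pt_cross by blast
      with 2 show ?thesis by blast
    qed
  qed
  \<comment> \<open>The grid is nonempty, whereas an empty \<open>T\<close> would cover
    nothing.\<close>
  have "(1, 1) \<in> ?G" using n by simp
  with cover have "T \<noteq> {}" by blast
  with finT cT show s1: "s \<ge> 1" by (metis One_nat_def Suc_leI card_gt_0_iff)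
  then have r1: "sqrt (real s) \<ge> 1" by simp
  have pencil: "(\<Sum>y\<in>T - {x}. real (card (L x y))) \<le> 75 * real n * sqrt (real s)" if x: "x \<in> T" for x
  proof -
    let ?d = "\<lambda>y. prim_dir (y - x)"
    have inj: "inj_on ?d (T - {x})"
    proof (rule inj_onI, rule ccontr)
      fix y z assume yz: "y \<in> T - {x}" "z \<in> T - {x}" "?d y = ?d z" "y \<noteq> z"
      then have "collinear {real_pt x, real_pt y, real_pt z}"
        by (intro collinear_same_prim_dir) auto
      moreover have "real_pt x \<noteq> real_pt y" "real_pt y \<noteq> real_pt z" "real_pt x \<noteq> real_pt z"
        using yz inj_eq[OF inj_real_pt] by auto
      ultimately show False
        using gp x yz unfolding general_position_def T(2) by blast
    qed
    have "(\<Sum>y\<in>T - {x}. real (card (L x y)))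
        \<le> (\<Sum>y\<in>T - {x}. 3 * real n * (1 / real_of_int (supn (?d y))))"
    proof (rule sum_mono)
      fix y assume "y \<in> T - {x}"
      then show "real (card (L x y)) \<le> 3 * real n * (1 / real_of_int (supn (?d y)))"
        using card_grid_line_le[of x n y] x T(1) unfolding L_def by auto
    qed
    \<comment> \<open>Injectivity turns the sum over points into a sum over a set of distinct
      vectors, to which the norm estimate applies; 3 * 25 = 75.\<close>
    also have "\<dots> = 3 * real n * (\<Sum>v\<in>?d ` (T - {x}). 1 / real_of_int (supn v))"
      by (simp only: sum_distrib_left sum.reindex[OF inj] o_def)
    also have "\<dots> \<le> 3 * real n * (25 * sqrt (real s))"
    proof (rule mult_left_mono[OF sum_inverse_supn_le])
      show "card (?d ` (T - {x})) \<le> s"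
        using card_image_le[of "T - {x}" ?d] card_mono[of T "T - {x}"] finT cT by auto
      fix v assume "v \<in> ?d ` (T - {x})"
      then obtain y where "y \<noteq> x" "v = ?d y" by blast
      then show "1 \<le> supn v" using supn_prim_dir(1)[of "y - x"] by simp
    next
    qed (use finT s1 in simp_all)
    finally show ?thesis by simp
  qed
  have finL: "finite (L x y)" for x y
    by (rule finite_subset[of _ ?G]) (auto simp: L_def)
  have "n * n = card ?G" by (simp add: card_cartesian_product)
  also have "\<dots> \<le> card (T \<union> (\<Union>x\<in>T. \<Union>y\<in>T - {x}. L x y))"
    using finT finL by (intro card_mono[OF _ cover]) auto
  also have "\<dots> \<le> card T + card (\<Union>x\<in>T. \<Union>y\<in>T - {x}. L x y)"
    by (rule card_Un_le)
  \<comment> \<open>Plain union bound over ordered pairs: each line is counted from both of its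
    endpoints, at the cost of a constant only.\<close>
  also have "card (\<Union>x\<in>T. \<Union>y\<in>T - {x}. L x y) \<le> (\<Sum>x\<in>T. \<Sum>y\<in>T - {x}. card (L x y))"
    using finT by (intro order_trans[OF card_UN_le] sum_mono card_UN_le) auto
  finally have "n * n \<le> s + (\<Sum>x\<in>T. \<Sum>y\<in>T - {x}. card (L x y))"
    by (simp add: cT)
  then have "real (n * n) \<le> real (s + (\<Sum>x\<in>T. \<Sum>y\<in>T - {x}. card (L x y)))"
    by (rule of_nat_mono)
  then have "real n * real n \<le> real s + (\<Sum>x\<in>T. \<Sum>y\<in>T - {x}. real (card (L x y)))"
    by simp
  also have "\<dots> \<le> real s + (\<Sum>x\<in>T. 75 * real n * sqrt (real s))"
    using pencil by (intro add_left_mono sum_mono)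
  also have "\<dots> = real s + 75 * real n * (real s * sqrt (real s))"
    by (simp add: cT)
  \<comment> \<open>The lone term \<open>s\<close> is absorbed using \<open>n \<ge> 1\<close> and
    \<open>sqrt s \<ge> 1\<close>, raising 75 to 76; afterwards one factor \<open>n\<close>
    cancels.\<close>
  also have "\<dots> \<le> real n * (real s * sqrt (real s)) + 75 * real n * (real s * sqrt (real s))"
  proof (rule add_right_mono)
    have "1 * (real s * 1) \<le> real n * (real s * sqrt (real s))"
      using n r1 by (intro mult_mono) auto
    then show "real s \<le> real n * (real s * sqrt (real s))" by simp
  qed
  finally have "real n * real n \<le> real n * (76 * (real s * sqrt (real s)))" by simp
  then show "real n \<le> 76 * (real s * sqrt (real s))"
    using n by (simp only: mult_le_cancel_left_pos of_nat_0_less_iff)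
qed

theorem corollary1:
  "\<exists>c::real. c > 0 \<and>
     (\<forall>n::nat. n \<ge> 1 \<longrightarrow> real (indep_geom_dom_number n) \<ge> c * real n powr (2 / 3))"
proof (intro exI[of _ "(1 / 76) powr (2 / 3) :: real"] conjI allI impI)
  fix n :: nat assume n: "n \<ge> 1"
  define s where "s = indep_geom_dom_number n"
  obtain S where S: "geom_dominating n S" "general_position S" "card S = s"
    using indep_geom_dom_number_attained unfolding s_def by blast
  have s1: "s \<ge> 1" and bound: "real n \<le> 76 * (real s * sqrt (real s))"
    using dominating_general_position_bound[OF S(1,2) n] S(3) by auto
  have "real s * sqrt (real s) = real s powr 1 * real s powr (1 / 2)"
    using s1 by (simp add: powr_half_sqrt)
  also have "\<dots> = real s powr (3 / 2)"
    by (simp only: powr_add[symmetric]) simp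
  finally have eq: "real s * sqrt (real s) = real s powr (3 / 2)" .
  \<comment> \<open>Raising \<open>n / 76 \<le> s powr (3 / 2)\<close> to the power 2/3 isolates
    \<open>s\<close> and explains the chosen witness for \<open>c\<close>.\<close>
  have "(1 / 76 * real n) powr (2 / 3) \<le> (real s powr (3 / 2)) powr (2 / 3)"
    using bound unfolding eq by (intro powr_mono2) auto
  also have "\<dots> = real s"
    using s1 by (simp add: powr_powr)
  also have "(1 / 76 * real n) powr (2 / 3) = (1 / 76) powr (2 / 3) * real n powr (2 / 3)"
    by (rule powr_mult)
  finally show "(1 / 76) powr (2 / 3) * real n powr (2 / 3) \<le> real (indep_geom_dom_number n)"
    by (simp add: s_def)
qed simp

end
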